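(* Let $(Q,\cdot,\backslash,/)$ be a middle Bol loop and let $g_1:Q^2\to Q$ be defined by $g_1(x,y)=(xy)\backslash x$ or $g_1(x,y)=x\backslash(x/y)$. Below each identity is required for all $x,y\in Q$. 1. $(Q,\cdot)$ satisfies $(xy)x=x(yx)$ if and only if $g_1(x,y)=x\cdot g_1(x,yx)$. 2. $(Q,\cdot)$ satisfies $((xy)x)x=x((yx)x)$ if and only if $g_1(x,y)=x\cdot\big(x\cdot g_1(x,(yx)x)\big)$. 3. $(Q,\cdot)$ satisfies $((xy)x)x=x(y(xx))$ if and only if $g_1(x,y)=x\cdot\big(x\cdot g_1(x,y(xx))\big)$. 4. If $(Q,\cdot)$ satisfies $(xy)y=x(yy)$, then the following are equivalent: (a) $(Q,\cdot)$ satisfies $((xy)x)x=x((yx)x)$. (b) $(Q,\cdot)$ satisfies $((xy)x)x=x(y(xx))$. (c) $(Q,\cdot)$ satisfies $(xy)(xx)=x(y(xx))$.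
   Context: A loop $(Q,\cdot,\backslash,/)$ is a loop $(Q,\cdot)$ with identity $e$, where $x\backslash y$ is the unique $z$ with $x\cdot z=y$ and $x/y$ is the unique $z$ with $z\cdot y=x$. It is a middle Bol loop if $x((yz)\backslash x)=(x/z)(y\backslash x)$ for all $x,y,z$. In a middle Bol loop the two expressions given for $g_1$ agree. *)

theory Defs
  imports Main
begin

text \<open>Both divisions are constrained on the carrier only; their values outside \<open>Q\<close> are irrelevant.\<close>

locale loop =
  fixes Q :: "'a set"
    and mult :: "'a \<Rightarrow> 'a \<Rightarrow> 'a"  (infixl "\<cdot>" 70)
    and ldiv :: "'a \<Rightarrow> 'a \<Rightarrow> 'a"  (infixl "\<setminus>" 70)
    and rdiv :: "'a \<Rightarrow> 'a \<Rightarrow> 'a"  (infixl "\<div>" 70)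
    and e :: 'a
  assumes mult_closed: "\<lbrakk>x \<in> Q; y \<in> Q\<rbrakk> \<Longrightarrow> x \<cdot> y \<in> Q"
    and e_closed: "e \<in> Q"
    and left_identity: "x \<in> Q \<Longrightarrow> e \<cdot> x = x"
    and right_identity: "x \<in> Q \<Longrightarrow> x \<cdot> e = x"
    and left_solvable: "\<lbrakk>x \<in> Q; y \<in> Q\<rbrakk> \<Longrightarrow> \<exists>!z. z \<in> Q \<and> x \<cdot> z = y"
    and right_solvable: "\<lbrakk>x \<in> Q; y \<in> Q\<rbrakk> \<Longrightarrow> \<exists>!z. z \<in> Q \<and> z \<cdot> y = x"
    and ldiv_eq: "\<lbrakk>x \<in> Q; y \<in> Q\<rbrakk> \<Longrightarrow> x \<setminus> y = (THE z. z \<in> Q \<and> x \<cdot> z = y)"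
    and rdiv_eq: "\<lbrakk>x \<in> Q; y \<in> Q\<rbrakk> \<Longrightarrow> x \<div> y = (THE z. z \<in> Q \<and> z \<cdot> y = x)"

locale middle_bol_loop = loop +
  assumes middle_bol: "\<lbrakk>x \<in> Q; y \<in> Q; z \<in> Q\<rbrakk> \<Longrightarrow>
    x \<cdot> ((y \<cdot> z) \<setminus> x) = (x \<div> z) \<cdot> (y \<setminus> x)"

end

theory Submission
  imports Defs
begin

text \<open>
  Write \<open>g x y = (x \<cdot> y) \<setminus> x\<close>. Specialising the middle Bol identity to \<open>y = x\<close> gives
  \<open>x \<cdot> g x z = x \<div> z\<close>, so every right-hand side of the form \<open>x \<cdot> g x w\<close> is a right
  division \<open>x \<div> w\<close>.

  The other half of the argument computes \<open>g x y\<close> itself as such a division: \<open>u \<setminus> x = x \<div> w\<close> holds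
  exactly when \<open>u \<cdot> x = x \<cdot> w\<close> (lemma \<open>ldiv_eq_rdiv_iff\<close>). Taking \<open>u = x \<cdot> y\<close>, the identity
  \<open>g x y = x \<cdot> g x w\<close> holds exactly when \<open>x \<cdot> w = (x \<cdot> y) \<cdot> x\<close>. Moreover the middle Bol identity
  with \<open>z = x\<close> cancels a right factor \<open>x\<close>: \<open>x \<cdot> ((u \<cdot> x) \<setminus> x) = u \<setminus> x\<close>. Hence \<open>g x y = x \<cdot> (x \<cdot> g x w)\<close>
  holds exactly when \<open>x \<cdot> w = ((x \<cdot> y) \<cdot> x) \<cdot> x\<close>. These are the lemmas \<open>ldiv_self_shift_iff\<close> and
  \<open>ldiv_self_double_shift_iff\<close>; the first three equivalences are the cases \<open>w = y \<cdot> x\<close>,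
  \<open>w = (y \<cdot> x) \<cdot> x\<close> and \<open>w = y \<cdot> (x \<cdot> x)\<close>, and they hold for each pair \<open>x\<close>, \<open>y\<close> separately.

  In the fourth part, the three identities become the same equation: the right alternative law
  identifies \<open>(y \<cdot> x) \<cdot> x\<close> with \<open>y \<cdot> (x \<cdot> x)\<close> and \<open>((x \<cdot> y) \<cdot> x) \<cdot> x\<close> with \<open>(x \<cdot> y) \<cdot> (x \<cdot> x)\<close>.
\<close>

context loop
begin

lemma ldiv_closed: "\<lbrakk>x \<in> Q; y \<in> Q\<rbrakk> \<Longrightarrow> x \<setminus> y \<in> Q"
  and mult_ldiv: "\<lbrakk>x \<in> Q; y \<in> Q\<rbrakk> \<Longrightarrow> x \<cdot> (x \<setminus> y) = y"
  using theI'[OF left_solvable[of x y]] ldiv_eq[of x y] by simp_all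

lemma rdiv_closed: "\<lbrakk>x \<in> Q; y \<in> Q\<rbrakk> \<Longrightarrow> x \<div> y \<in> Q"
  and rdiv_mult: "\<lbrakk>x \<in> Q; y \<in> Q\<rbrakk> \<Longrightarrow> (x \<div> y) \<cdot> y = x"
  using theI'[OF right_solvable[of x y]] rdiv_eq[of x y] by simp_all

lemma left_cancel: "\<lbrakk>x \<in> Q; y \<in> Q; z \<in> Q\<rbrakk> \<Longrightarrow> x \<cdot> y = x \<cdot> z \<longleftrightarrow> y = z"
  using left_solvable[of x "x \<cdot> y"] mult_closed by metis

lemma right_cancel: "\<lbrakk>x \<in> Q; y \<in> Q; z \<in> Q\<rbrakk> \<Longrightarrow> y \<cdot> x = z \<cdot> x \<longleftrightarrow> y = z"
  using right_solvable[of "y \<cdot> x" x] mult_closed by metis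

lemma ldiv_unique: "\<lbrakk>x \<in> Q; z \<in> Q; x \<cdot> z = y\<rbrakk> \<Longrightarrow> x \<setminus> y = z"
  using left_cancel[of x "x \<setminus> y" z] mult_ldiv[of x y] ldiv_closed[of x y] mult_closed by blast

lemma rdiv_unique: "\<lbrakk>y \<in> Q; z \<in> Q; z \<cdot> y = x\<rbrakk> \<Longrightarrow> x \<div> y = z"
  using right_cancel[of y "x \<div> y" z] rdiv_mult[of x y] rdiv_closed[of x y] mult_closed by blast

end

context middle_bol_loop
begin

text \<open>The case \<open>y = x\<close> of the middle Bol identity, where the factor \<open>y \<setminus> x\<close> is the identity element.\<close>

lemma mult_ldiv_self_eq_rdiv:
  assumes x: "x \<in> Q" and z: "z \<in> Q"
  shows "x \<cdot> ((x \<cdot> z) \<setminus> x) = x \<div> z"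
proof -
  have "x \<setminus> x = e"
    using x e_closed right_identity by (intro ldiv_unique) auto
  then show ?thesis
    using middle_bol[OF x x z] right_identity rdiv_closed[OF x z] by simp
qed

lemma ldiv_self_eq_ldiv_rdiv:
  assumes x: "x \<in> Q" and z: "z \<in> Q"
  shows "(x \<cdot> z) \<setminus> x = x \<setminus> (x \<div> z)"
  using ldiv_unique[OF x _ mult_ldiv_self_eq_rdiv[OF x z]] x z
  by (simp add: ldiv_closed mult_closed)

text \<open>The case \<open>z = x\<close> of the middle Bol identity, where the factor \<open>x \<div> z\<close> is the identity element.\<close>

lemma mult_ldiv_cancel_right:
  assumes x: "x \<in> Q" and u: "u \<in> Q"
  shows "x \<cdot> ((u \<cdot> x) \<setminus> x) = u \<setminus> x"
proof -
  have "x \<div> x = e"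
    using x e_closed left_identity by (intro rdiv_unique) auto
  then show ?thesis
    using middle_bol[OF x u x] left_identity ldiv_closed[OF u x] by simp
qed

text \<open>
  Both specialisations above compute a left multiple by \<open>x\<close>: the second of \<open>(u \<cdot> x) \<setminus> x\<close>, the
  first of \<open>(x \<cdot> w) \<setminus> x\<close>. Hence \<open>u \<setminus> x\<close> and \<open>x \<div> w\<close> can be compared by comparing \<open>u \<cdot> x\<close>
  with \<open>x \<cdot> w\<close>, since \<open>t \<setminus> x\<close> determines \<open>t\<close>.
\<close>

lemma ldiv_eq_rdiv_iff:
  assumes x: "x \<in> Q" and u: "u \<in> Q" and w: "w \<in> Q"
  shows "u \<setminus> x = x \<div> w \<longleftrightarrow> u \<cdot> x = x \<cdot> w"
proof -
  have ux: "u \<cdot> x \<in> Q" and xw: "x \<cdot> w \<in> Q"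
    using x u w mult_closed by auto
  have "u \<setminus> x = x \<div> w \<longleftrightarrow> x \<cdot> ((u \<cdot> x) \<setminus> x) = x \<cdot> ((x \<cdot> w) \<setminus> x)"
    using x u w by (simp add: mult_ldiv_cancel_right mult_ldiv_self_eq_rdiv)
  also have "\<dots> \<longleftrightarrow> (u \<cdot> x) \<setminus> x = (x \<cdot> w) \<setminus> x"
    using x ux xw by (simp add: left_cancel ldiv_closed)
  also have "\<dots> \<longleftrightarrow> u \<cdot> x = x \<cdot> w"
    using right_cancel[OF ldiv_closed[OF ux x] ux xw] mult_ldiv[OF ux x] mult_ldiv[OF xw x]
    by auto
  finally show ?thesis .
qed

text \<open>Since \<open>x \<cdot> ((x \<cdot> w) \<setminus> x) = x \<div> w\<close>, the comparison applies with \<open>u = x \<cdot> y\<close>.\<close>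

lemma ldiv_self_shift_iff:
  assumes x: "x \<in> Q" and y: "y \<in> Q" and w: "w \<in> Q"
  shows "(x \<cdot> y) \<setminus> x = x \<cdot> ((x \<cdot> w) \<setminus> x) \<longleftrightarrow> (x \<cdot> y) \<cdot> x = x \<cdot> w"
  using ldiv_eq_rdiv_iff[OF x mult_closed[OF x y] w] mult_ldiv_self_eq_rdiv[OF x w] by simp

text \<open>
  Rewriting the left-hand side as \<open>x \<cdot> (((x \<cdot> y) \<cdot> x) \<setminus> x)\<close> exposes a common left factor \<open>x\<close>;
  after cancelling it, the comparison applies with \<open>u = (x \<cdot> y) \<cdot> x\<close>.
\<close>

lemma ldiv_self_double_shift_iff:
  assumes x: "x \<in> Q" and y: "y \<in> Q" and w: "w \<in> Q"
  shows "(x \<cdot> y) \<setminus> x = x \<cdot> (x \<cdot> ((x \<cdot> w) \<setminus> x)) \<longleftrightarrow> ((x \<cdot> y) \<cdot> x) \<cdot> x = x \<cdot> w"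
proof -
  have xy: "x \<cdot> y \<in> Q" and xyx: "(x \<cdot> y) \<cdot> x \<in> Q"
    using x y mult_closed by auto
  have "(x \<cdot> y) \<setminus> x = x \<cdot> (x \<cdot> ((x \<cdot> w) \<setminus> x)) \<longleftrightarrow>
      x \<cdot> (((x \<cdot> y) \<cdot> x) \<setminus> x) = x \<cdot> (x \<div> w)"
    using mult_ldiv_cancel_right[OF x xy] mult_ldiv_self_eq_rdiv[OF x w] by simp
  also have "\<dots> \<longleftrightarrow> ((x \<cdot> y) \<cdot> x) \<setminus> x = x \<div> w"
    using x w xyx by (simp add: left_cancel ldiv_closed rdiv_closed)
  also have "\<dots> \<longleftrightarrow> ((x \<cdot> y) \<cdot> x) \<cdot> x = x \<cdot> w"
    by (rule ldiv_eq_rdiv_iff[OF x xyx w])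
  finally show ?thesis .
qed

end

theorem theorem2p5:
  fixes Q :: "'a set"
    and mult :: "'a \<Rightarrow> 'a \<Rightarrow> 'a"  (infixl "\<cdot>" 70)
    and ldiv :: "'a \<Rightarrow> 'a \<Rightarrow> 'a"  (infixl "\<setminus>" 70)
    and rdiv :: "'a \<Rightarrow> 'a \<Rightarrow> 'a"  (infixl "\<div>" 70)
    and e :: 'a
    and g\<^sub>1 :: "'a \<Rightarrow> 'a \<Rightarrow> 'a"
  assumes "middle_bol_loop Q (\<cdot>) (\<setminus>) (\<div>) e"
    and "(\<forall>x\<in>Q. \<forall>y\<in>Q. g\<^sub>1 x y = (x \<cdot> y) \<setminus> x) \<or>
         (\<forall>x\<in>Q. \<forall>y\<in>Q. g\<^sub>1 x y = x \<setminus> (x \<div> y))"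
  shows
    "((\<forall>x\<in>Q. \<forall>y\<in>Q. (x \<cdot> y) \<cdot> x = x \<cdot> (y \<cdot> x)) \<longleftrightarrow>
      (\<forall>x\<in>Q. \<forall>y\<in>Q. g\<^sub>1 x y = x \<cdot> g\<^sub>1 x (y \<cdot> x)))
   \<and> ((\<forall>x\<in>Q. \<forall>y\<in>Q. ((x \<cdot> y) \<cdot> x) \<cdot> x = x \<cdot> ((y \<cdot> x) \<cdot> x)) \<longleftrightarrow>
      (\<forall>x\<in>Q. \<forall>y\<in>Q. g\<^sub>1 x y = x \<cdot> (x \<cdot> g\<^sub>1 x ((y \<cdot> x) \<cdot> x))))
   \<and> ((\<forall>x\<in>Q. \<forall>y\<in>Q. ((x \<cdot> y) \<cdot> x) \<cdot> x = x \<cdot> (y \<cdot> (x \<cdot> x))) \<longleftrightarrow>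
      (\<forall>x\<in>Q. \<forall>y\<in>Q. g\<^sub>1 x y = x \<cdot> (x \<cdot> g\<^sub>1 x (y \<cdot> (x \<cdot> x)))))
   \<and> ((\<forall>x\<in>Q. \<forall>y\<in>Q. (x \<cdot> y) \<cdot> y = x \<cdot> (y \<cdot> y)) \<longrightarrow>
      ((\<forall>x\<in>Q. \<forall>y\<in>Q. ((x \<cdot> y) \<cdot> x) \<cdot> x = x \<cdot> ((y \<cdot> x) \<cdot> x)) \<longleftrightarrow>
       (\<forall>x\<in>Q. \<forall>y\<in>Q. ((x \<cdot> y) \<cdot> x) \<cdot> x = x \<cdot> (y \<cdot> (x \<cdot> x)))) \<and>
      ((\<forall>x\<in>Q. \<forall>y\<in>Q. ((x \<cdot> y) \<cdot> x) \<cdot> x = x \<cdot> (y \<cdot> (x \<cdot> x))) \<longleftrightarrow>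
       (\<forall>x\<in>Q. \<forall>y\<in>Q. (x \<cdot> y) \<cdot> (x \<cdot> x) = x \<cdot> (y \<cdot> (x \<cdot> x)))))"
proof -
  interpret middle_bol_loop Q "(\<cdot>)" "(\<setminus>)" "(\<div>)" e
    by (rule assms(1))
  have g: "g\<^sub>1 x y = (x \<cdot> y) \<setminus> x" if "x \<in> Q" "y \<in> Q" for x y
    using assms(2) that ldiv_self_eq_ldiv_rdiv by auto
  have flexible: "(x \<cdot> y) \<cdot> x = x \<cdot> (y \<cdot> x) \<longleftrightarrow> g\<^sub>1 x y = x \<cdot> g\<^sub>1 x (y \<cdot> x)"
    if "x \<in> Q" "y \<in> Q" for x y
    using that by (simp add: g mult_closed ldiv_self_shift_iff)
  have double: "((x \<cdot> y) \<cdot> x) \<cdot> x = x \<cdot> w \<longleftrightarrow> g\<^sub>1 x y = x \<cdot> (x \<cdot> g\<^sub>1 x w)"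
    if "x \<in> Q" "y \<in> Q" "w \<in> Q" for x y w
    using that by (simp add: g ldiv_self_double_shift_iff)
  have right_alternative:
    "(\<forall>x\<in>Q. \<forall>y\<in>Q. ((x \<cdot> y) \<cdot> x) \<cdot> x = x \<cdot> ((y \<cdot> x) \<cdot> x)) \<longleftrightarrow>
     (\<forall>x\<in>Q. \<forall>y\<in>Q. ((x \<cdot> y) \<cdot> x) \<cdot> x = x \<cdot> (y \<cdot> (x \<cdot> x)))"
    "(\<forall>x\<in>Q. \<forall>y\<in>Q. ((x \<cdot> y) \<cdot> x) \<cdot> x = x \<cdot> (y \<cdot> (x \<cdot> x))) \<longleftrightarrow>
     (\<forall>x\<in>Q. \<forall>y\<in>Q. (x \<cdot> y) \<cdot> (x \<cdot> x) = x \<cdot> (y \<cdot> (x \<cdot> x)))"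
    if "\<forall>x\<in>Q. \<forall>y\<in>Q. (x \<cdot> y) \<cdot> y = x \<cdot> (y \<cdot> y)"
    using that by (simp_all add: mult_closed)
  show ?thesis
    using right_alternative by (simp add: flexible double mult_closed)
qed

end
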